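(* Let $d\ge 1$ and $m_1,\dots,m_d$ be positive integers, and let $M=[0,m_1]\times\cdots\times[0,m_d]\subset\mathbb{R}^d$. Then the minimum cardinality of a maximal system of brick islands in $M$ is \[ g_d(m_1,\dots,m_d)=\sum_{i=1}^d m_i-(d-1). \]
   Context: A brick of $M$ is a set $[a_1,b_1]\times\cdots\times[a_d,b_d]$ with $a_i,b_i\in\mathbb{Z}$ and $0\le a_i<b_i\le m_i$ for each $i$. A system of brick islands in $M$ is a set $H$ of bricks of $M$ such that for any $M_1,M_2\in H$, either $M_1\subseteq M_2$, $M_2\subseteq M_1$, or $M_1\cap M_2=\emptyset$. Let $I_M$ be the set of all systems of brick islands in $M$ and $Max(I_M)$ the set of its maximal elements with respect to inclusion (maximal systems). Define $g_d(m_1,\dots,m_d)=\min\{|H|: H\in Max(I_M)\}$. *)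

theory Defs
  imports "HOL-Analysis.Analysis"
begin

text \<open>The ambient box \<open>M = [0, m\<^sub>1] \<times> \<dots> \<times> [0, m\<^sub>d]\<close> is represented by its vector
  of side lengths \<open>m\<close>; the index type \<open>'d\<close> plays the role of \<open>{1, \<dots>, d}\<close>.\<close>

definition bricks :: "('d::finite \<Rightarrow> nat) \<Rightarrow> (real ^ 'd) set set" where
  "bricks m = {cbox (\<chi> i. real_of_int (a i)) (\<chi> i. real_of_int (b i)) | a b.
     \<forall>i. 0 \<le> a i \<and> a i < b i \<and> b i \<le> int (m i)}"

definition brick_island_systems :: "('d::finite \<Rightarrow> nat) \<Rightarrow> (real ^ 'd) set set set" where
  "brick_island_systems m = {H. H \<subseteq> bricks m \<and>
     (\<forall>A\<in>H. \<forall>B\<in>H. A \<subseteq> B \<or> B \<subseteq> A \<or> A \<inter> B = {})}"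

definition maximal_brick_island_systems ::
    "('d::finite \<Rightarrow> nat) \<Rightarrow> (real ^ 'd) set set set" where
  "maximal_brick_island_systems m =
     {H \<in> brick_island_systems m. \<forall>H'\<in>brick_island_systems m. H \<subseteq> H' \<longrightarrow> H' = H}"

definition min_maximal_brick_islands :: "('d::finite \<Rightarrow> nat) \<Rightarrow> nat" where
  "min_maximal_brick_islands m = Min (card ` maximal_brick_island_systems m)"

text \<open>The following facts show that \<^const>\<open>Min\<close> and \<^const>\<open>card\<close> are only applied where they
  have their usual meaning.\<close>

lemma finite_bricks: "finite (bricks m)"
proof -
  let ?F = "(UNIV :: 'a set) \<rightarrow>\<^sub>E {0..int (Max (range m))}"
  have "finite (?F \<times> ?F)"
    by (intro finite_cartesian_product finite_PiE) auto
  moreover have "bricks m \<subseteq> (\<lambda>(a, b). cbox (\<chi> i. real_of_int (a i)) (\<chi> i. real_of_int (b i))) ` (?F \<times> ?F)"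
  proof
    fix B assume "B \<in> bricks m"
    then obtain a b where B: "B = cbox (\<chi> i. real_of_int (a i)) (\<chi> i. real_of_int (b i))"
      and ab: "\<And>i. 0 \<le> a i \<and> a i < b i \<and> b i \<le> int (m i)"
      by (auto simp: bricks_def)
    have "m i \<le> Max (range m)" for i
      by simp
    then have "0 \<le> a i \<and> a i \<le> int (Max (range m)) \<and> 0 \<le> b i \<and> b i \<le> int (Max (range m))" for i
      using ab[of i] by (smt (verit) of_nat_le_iff)
    then have "(a, b) \<in> ?F \<times> ?F"
      by (auto simp: PiE_def)
    then show "B \<in> (\<lambda>(a, b). cbox (\<chi> i. real_of_int (a i)) (\<chi> i. real_of_int (b i))) ` (?F \<times> ?F)"
      using B by (intro image_eqI[of _ _ "(a, b)"]) auto
  qed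
  ultimately show ?thesis
    by (rule finite_surj)
qed

lemma finite_brick_island_systems: "finite (brick_island_systems m)"
  by (rule finite_subset[of _ "Pow (bricks m)"]) (auto simp: brick_island_systems_def finite_bricks)

lemma finite_brick_island_system: "H \<in> brick_island_systems m \<Longrightarrow> finite H"
  using finite_bricks finite_subset by (auto simp: brick_island_systems_def)

lemma finite_maximal_brick_island_systems: "finite (maximal_brick_island_systems m)"
  unfolding maximal_brick_island_systems_def
  by (rule finite_subset[OF _ finite_brick_island_systems[of m]]) auto

lemma maximal_brick_island_systems_nonempty: "maximal_brick_island_systems m \<noteq> {}"
proof -
  have "{} \<in> brick_island_systems m"
    by (simp add: brick_island_systems_def)
  then obtain H where "H \<in> brick_island_systems m"
    and "\<forall>H'\<in>brick_island_systems m. H \<subseteq> H' \<longrightarrow> H = H'"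
    using finite_has_maximal[OF finite_brick_island_systems, of m] by blast
  then have "H \<in> maximal_brick_island_systems m"
    by (auto simp: maximal_brick_island_systems_def)
  then show ?thesis
    by blast
qed

end

theory Submission
  imports Defs
begin

text \<open>
  Call \<open>\<Sum>\<^sub>i (m\<^sub>i - 1)\<close> the number of cuts of the box \<open>M\<close>: a cut is an integer hyperplane \<open>x\<^sub>i = t\<close>
  meeting its interior. Shaving off unit slabs one at a time until a unit cube is left gives a
  maximal system with one brick more than there are cuts.

  Conversely, let \<open>H\<close> be maximal and let \<open>F\<close> be the set of maximal members of \<open>H - {M}\<close>. Below each
  \<open>B \<in> F\<close> the system is maximal in \<open>B\<close>, so by induction it suffices that at most \<open>|F|\<close> cuts of \<open>M\<close> are
  cuts of no \<open>B \<in> F\<close>. Suppose no member of \<open>F\<close> is all of one side of a cut (that case is easy). For an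
  uncovered cut the two parts of \<open>M\<close> cannot be added to \<open>H\<close>, so members of \<open>F\<close> abut on it from both sides;
  a brick at distance 1 from the boundary of \<open>M\<close> could be enlarged, so the outermost layers between
  uncovered cuts have width at least 2; and every unit cube meets some \<open>B \<in> F\<close>. Hence in the grid of
  layers cut out by the uncovered cuts, every layer contains a member of \<open>F\<close>, and so does every product
  of windows, each consisting of an outermost layer or of three consecutive layers. Counting
  yields \<open>|F|\<close> at least the number of uncovered cuts.
\<close>

section \<open>Counting in a grid of layers\<close>

text \<open>The layers are numbered \<open>0, \<dots>, u\<close>; the window around a layer \<open>p\<close> is \<open>{p - 1, p, p + 1}\<close>,
  except that outermost layers form windows by themselves. Distinct centres have disjoint windows.\<close>

definition near :: "nat \<Rightarrow> nat \<Rightarrow> nat \<Rightarrow> bool" where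
  "near u p c \<longleftrightarrow> (p = 0 \<longrightarrow> c = 0) \<and> (p = u \<longrightarrow> c = u) \<and> c \<le> p + 1 \<and> p \<le> c + 1"

text \<open>The inner layers \<open>1, ..., u - 1\<close> are grouped from the left into triples,
  and \<open>3 * k + 2\<close> is the middle of triple \<open>k\<close>; up to two inner layers are
  left over. For \<open>u = 0\<close> the two outermost layers coincide.\<close>

definition centres :: "nat \<Rightarrow> nat set" where
  "centres u = {0, u} \<union> (\<lambda>k. 3 * k + 2) ` {..<(u - 1) div 3}"

lemma centres_le: "p \<in> centres u \<Longrightarrow> p \<le> u"
  by (auto simp: centres_def)

lemma finite_centres [simp]: "finite (centres u)"
  by (simp add: centres_def)

lemma near_centres_unique:
  assumes "p \<in> centres u" "p' \<in> centres u" "near u p c" "near u p' c"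
  shows "p = p'"
  using assms unfolding centres_def near_def by auto

lemma card_centres_0 [simp]: "card (centres 0) = 1"
  by (simp add: centres_def)

lemma card_centres:
  assumes "u > 0"
  shows "card (centres u) = (u - 1) div 3 + 2"
proof -
  have "card ((\<lambda>k. 3 * k + 2) ` {..<(u - 1) div 3}) = (u - 1) div 3"
    by (subst card_image) (auto simp: inj_on_def)
  moreover have "{0, u} \<inter> (\<lambda>k. 3 * k + 2) ` {..<(u - 1) div 3} = {}"
    by auto
  ultimately show ?thesis
    using assms by (simp add: centres_def card_Un_disjoint)
qed

text \<open>Each inner centre accounts for three inner layers and at most two are left over. Later
  this bounds \<open>u\<close> by three times \<open>card (centres u) - 1\<close>.\<close>

lemma le_three_card_centres: "u + 3 \<le> 3 * card (centres u)"
proof (cases "u = 0")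
  case False
  then have "card (centres u) = (u - 1) div 3 + 2" by (simp add: card_centres)
  then show ?thesis using False by presburger
qed simp

section \<open>Elementary estimates for sums and products\<close>

lemma prod_Suc_ge_sum:
  fixes w :: "'a \<Rightarrow> nat"
  assumes "finite A"
  shows "1 + (\<Sum>i\<in>A. w i) \<le> (\<Prod>i\<in>A. 1 + w i)"
  using assms
proof (induction A rule: finite_induct)
  case (insert x A)
  have "1 + (w x + sum w A) \<le> (1 + w x) * (1 + sum w A)"
    by simp
  also have "\<dots> \<le> (1 + w x) * (\<Prod>i\<in>A. 1 + w i)"
    by (rule mult_le_mono2) (use insert in simp)
  finally show ?case using insert by simp
qed simp

text \<open>The factor 2 comes from the two positive weights: \<open>(a + 2) * (b + 2)\<close> is at
  least \<open>2 * (a + b + 2)\<close> and at least 2, and the other factors multiply to at least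
  \<open>1 + r\<close>.\<close>

lemma prod_Suc_ge_double_sum:
  fixes w :: "'a \<Rightarrow> nat"
  assumes "finite A" "j \<in> A" "k \<in> A" "j \<noteq> k" "w j > 0" "w k > 0"
  shows "2 * (\<Sum>i\<in>A. w i) \<le> (\<Prod>i\<in>A. 1 + w i)"
proof -
  define R where "R = A - {j, k}"
  have A: "A = insert j (insert k R)" and R: "finite R" "j \<notin> R" "k \<notin> R"
    using assms by (auto simp: R_def)
  define r where "r = sum w R"
  obtain a b where ab: "w j = Suc a" "w k = Suc b"
    using assms by (metis gr0_implies_Suc)
  have "2 * (w j + w k + r) \<le> ((1 + w j) * (1 + w k)) * (1 + r)"
    by (simp add: ab algebra_simps)
  also have "\<dots> \<le> ((1 + w j) * (1 + w k)) * (\<Prod>i\<in>R. 1 + w i)"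
    unfolding r_def by (rule mult_le_mono2) (rule prod_Suc_ge_sum[OF R(1)])
  finally show ?thesis
    using R assms(4) by (simp add: A r_def algebra_simps)
qed

text \<open>Triples are peeled off from the left. Each contributes a surplus \<open>e\<close> over
  one per term; the one or two terms left at the end contribute 1 each.\<close>

lemma sum_ge_of_triples:
  fixes a :: "nat \<Rightarrow> nat"
  assumes "\<And>x. l < x \<Longrightarrow> x < r \<Longrightarrow> 1 \<le> a x"
    and "\<And>x. l < x \<Longrightarrow> x + 2 < r \<Longrightarrow> 3 + e \<le> a x + a (x + 1) + a (x + 2)"
    and "l < r"
  shows "(r - l - 1) + e * ((r - l - 1) div 3) \<le> (\<Sum>x\<in>{l<..<r}. a x)"
  using assms
proof (induction "r - l" arbitrary: l rule: less_induct)
  case less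
  consider "r = l + 1" | "r = l + 2" | "r = l + 3" | "l + 3 < r"
    using less.prems(3) by linarith
  then show ?case
  proof cases
    case 1
    then show ?thesis by simp
  next
    case 2
    then have "{l<..<r} = {l + 1}" by auto
    then show ?thesis using less.prems(1)[of "l + 1"] 2 by simp
  next
    case 3
    then have "{l<..<r} = {l + 1, l + 2}" by auto
    then show ?thesis using less.prems(1)[of "l + 1"] less.prems(1)[of "l + 2"] 3 by simp
  next
    case 4
    have "(r - (l + 3) - 1) + e * ((r - (l + 3) - 1) div 3) \<le> (\<Sum>x\<in>{l + 3<..<r}. a x)"
      using 4 less.prems by (intro less.hyps) auto
    moreover have "{l<..<r} = {l + 1, l + 2, l + 3} \<union> {l + 3<..<r}"
      using 4 by auto
    then have "(\<Sum>x\<in>{l<..<r}. a x) = a (l + 1) + a (l + 2) + a (l + 3) + (\<Sum>x\<in>{l + 3<..<r}. a x)"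
      by (simp add: sum.union_disjoint)
    moreover have "3 + e \<le> a (l + 1) + a (l + 2) + a (l + 3)"
      using less.prems(2)[of "l + 1"] 4 by (simp add: numeral_eq_Suc)
    moreover obtain n where n: "r = l + 4 + n"
      using 4 le_Suc_ex[of "l + 4" r] by auto
    ultimately show ?thesis by (simp add: algebra_simps)
  qed
qed

text \<open>\<open>c k i\<close> is the layer that contains \<open>k\<close> in direction \<open>i\<close>.\<close>

locale dense_profiles =
  fixes K :: "'b set" and c :: "'b \<Rightarrow> 'i::finite \<Rightarrow> nat" and u :: "'i \<Rightarrow> nat"
  assumes finite_K: "finite K"
    and le_u: "\<And>k i. k \<in> K \<Longrightarrow> c k i \<le> u i"
    and onto: "\<And>i l. l \<le> u i \<Longrightarrow> \<exists>k\<in>K. c k i = l"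
    and dense: "\<And>p. (\<And>i. p i \<le> u i) \<Longrightarrow> \<exists>k\<in>K. \<forall>i. near (u i) (p i) (c k i)"
begin

text \<open>Every choice of centres in the other directions gives a product of windows, which
  contains a member by \<open>dense\<close>. Windows of distinct centres are disjoint, so distinct
  choices yield distinct members. The layer \<open>y\<close> need not be a centre.\<close>

lemma card_near_ge:
  assumes "y \<le> u i0"
  shows "(\<Prod>i\<in>UNIV - {i0}. card (centres (u i))) \<le> card {k \<in> K. near (u i0) y (c k i0)}"
proof -
  define P where "P = PiE (UNIV - {i0}) (\<lambda>i. centres (u i))"
  have ex: "\<exists>k\<in>K. \<forall>i. near (u i) ((f(i0 := y)) i) (c k i)" if "f \<in> P" for f
  proof (rule dense)
    fix i
    have "i \<noteq> i0 \<Longrightarrow> f i \<in> centres (u i)"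
      using that by (auto simp: P_def)
    then show "(f(i0 := y)) i \<le> u i"
      using assms by (auto dest: centres_le)
  qed
  then obtain g where g: "\<And>f. f \<in> P \<Longrightarrow> g f \<in> K \<and> (\<forall>i. near (u i) ((f(i0 := y)) i) (c (g f) i))"
    by metis
  have "inj_on g P"
  proof (rule inj_onI)
    fix f h assume fh: "f \<in> P" "h \<in> P" "g f = g h"
    have "f i = h i" if "i \<noteq> i0" for i
    proof (rule near_centres_unique)
      show "f i \<in> centres (u i)" "h i \<in> centres (u i)"
        using fh that by (auto simp: P_def)
      show "near (u i) (f i) (c (g f) i)" "near (u i) (h i) (c (g f) i)"
        using g[OF fh(1)] g[OF fh(2)] fh(3) that by (metis fun_upd_other)+
    qed
    then show "f = h"
      using fh(1,2) unfolding P_def by (intro PiE_ext) auto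
  qed
  moreover have "g ` P \<subseteq> {k \<in> K. near (u i0) y (c k i0)}"
    using g by (fastforce dest: spec[of _ i0])
  ultimately have "card P \<le> card {k \<in> K. near (u i0) y (c k i0)}"
    using finite_K by (intro card_inj_on_le) auto
  then show ?thesis
    by (simp add: P_def card_PiE)
qed

definition layer :: "'i \<Rightarrow> nat \<Rightarrow> 'b set" where
  "layer i x = {k \<in> K. c k i = x}"

lemma finite_layer [simp]: "finite (layer i x)"
  by (simp add: layer_def finite_K)

lemma card_layer_pos: "x \<le> u i \<Longrightarrow> 1 \<le> card (layer i x)"
  using onto[of x i] by (auto simp: Suc_le_eq card_gt_0_iff layer_def finite_K)

lemma card_K_eq: "card K = (\<Sum>x\<le>u i. card (layer i x))"
proof -
  have "K = (\<Union>x\<in>{..u i}. layer i x)"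
    using le_u by (auto simp: layer_def)
  then have "card K = card (\<Union>x\<in>{..u i}. layer i x)"
    by simp
  also have "\<dots> = (\<Sum>x\<le>u i. card (layer i x))"
    by (rule card_UN_disjoint) (auto simp: layer_def finite_K)
  finally show ?thesis .
qed

lemma card_K_split:
  assumes "u i > 0"
  shows "card K = card (layer i 0) + card (layer i (u i)) + (\<Sum>x\<in>{0<..<u i}. card (layer i x))"
proof -
  have "{..u i} = insert 0 (insert (u i) {0<..<u i})"
    by auto
  then show ?thesis
    using assms by (simp add: card_K_eq[of i])
qed

lemma card_triple:
  "card (layer i x) + card (layer i (x + 1)) + card (layer i (x + 2)) =
   card (layer i x \<union> layer i (x + 1) \<union> layer i (x + 2))"
  by (subst card_Un_disjoint card_Un_disjoint, auto simp: layer_def finite_K)+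

text \<open>The bound that \<open>card_near_ge\<close> gives for every window in direction
  \<open>i\<close>.\<close>

abbreviation "width i \<equiv> (\<Prod>j\<in>UNIV - {i}. card (centres (u j)))"

lemma card_first_layer: "width i \<le> card (layer i 0)"
proof -
  have "{k \<in> K. near (u i) 0 (c k i)} \<subseteq> layer i 0"
    by (auto simp: near_def layer_def)
  then show ?thesis
    using card_near_ge[of 0 i] by (meson card_mono finite_layer order_trans zero_le)
qed

lemma card_last_layer: "width i \<le> card (layer i (u i))"
proof -
  have "{k \<in> K. near (u i) (u i) (c k i)} \<subseteq> layer i (u i)"
    by (auto simp: near_def layer_def)
  then show ?thesis
    using card_near_ge[of "u i" i] by (meson card_mono finite_layer order_trans order_refl)
qed

lemma card_triple_ge:
  assumes "0 < x" "x + 2 < u i"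
  shows "width i \<le> card (layer i x) + card (layer i (x + 1)) + card (layer i (x + 2))"
proof -
  have "{k \<in> K. near (u i) (x + 1) (c k i)} \<subseteq> layer i x \<union> layer i (x + 1) \<union> layer i (x + 2)"
    using assms by (auto simp: near_def layer_def)
  then have "card {k \<in> K. near (u i) (x + 1) (c k i)} \<le> card (layer i x \<union> layer i (x + 1) \<union> layer i (x + 2))"
    by (rule card_mono[rotated]) simp
  moreover have "width i \<le> card {k \<in> K. near (u i) (x + 1) (c k i)}"
    using assms by (intro card_near_ge) auto
  ultimately show ?thesis
    unfolding card_triple by simp
qed

text \<open>The two outermost layers are windows with at least \<open>width i\<close> members each,
  and each of the \<open>u i - 1\<close> inner layers is nonempty.\<close>

lemma card_K_ge:
  assumes "u i > 0"
  shows "2 * width i + u i - 1 \<le> card K"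
proof -
  have "(\<Sum>x\<in>{0<..<u i}. 1) \<le> (\<Sum>x\<in>{0<..<u i}. card (layer i x))"
    by (rule sum_mono) (simp add: card_layer_pos[simplified])
  then show ?thesis
    using card_K_split[OF assms] card_first_layer[of i] card_last_layer[of i] assms by simp
qed

text \<open>A refinement of \<open>card_K_ge\<close>: each triple of inner layers is a window, so it
  holds \<open>width i\<close> members rather than just 3.\<close>

lemma card_K_ge_triples:
  assumes "u i > 0" "3 \<le> width i"
  shows "2 * width i + (u i - 1) + (width i - 3) * ((u i - 1) div 3) \<le> card K"
proof -
  have "(u i - 0 - 1) + (width i - 3) * ((u i - 0 - 1) div 3) \<le> (\<Sum>x\<in>{0<..<u i}. card (layer i x))"
  proof (rule sum_ge_of_triples)
    show "1 \<le> card (layer i x)" if "0 < x" "x < u i" for x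
      using that by (intro card_layer_pos) simp
    show "3 + (width i - 3) \<le> card (layer i x) + card (layer i (x + 1)) + card (layer i (x + 2))"
      if "0 < x" "x + 2 < u i" for x
      using card_triple_ge[OF that] assms by simp
  qed (use assms in simp)
  then show ?thesis
    using card_K_split[OF assms(1)] card_first_layer[of i] card_last_layer[of i] by simp
qed

text \<open>The case in which the windows of three layers just fail to suffice: layer 1 in direction
  \<open>j\<close> is avoided by windows centred at 0, 4 and 6, so any of its members is an additional one.\<close>

lemma card_K_ge_six:
  assumes "i \<noteq> j" "u j = 6" "6 \<le> u i"
  shows "u i + 6 \<le> card K"
proof -
  \<comment> \<open>A set that contains \<open>b\<close> and a whole window in direction
    \<open>i\<close> has at least four elements: besides \<open>b\<close>, which is in layer 1 of
    direction \<open>j\<close>, one for each of the windows around 0, 4 and 6 in that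
    direction.\<close>
  have four: "4 \<le> card W" if W: "finite W" "\<And>k. k \<in> K \<Longrightarrow> near (u i) y (c k i) \<Longrightarrow> k \<in> W"
    and y: "y \<le> u i" and b: "b \<in> W" "c b j = 1" for W y b
  proof -
    have near_z: "\<exists>k\<in>W. near 6 z (c k j)" if "z \<le> 6" for z
    proof -
      have "((\<lambda>_. 0)(i := y, j := z)) l \<le> u l" for l
        using y that assms by auto
      from dense[OF this] obtain k
        where "k \<in> K" "\<forall>l. near (u l) (((\<lambda>_. 0)(i := y, j := z)) l) (c k l)"
        by blast
      then have "near (u i) y (c k i)" "near 6 z (c k j)"
        using assms by (metis fun_upd_same fun_upd_other)+
      then show ?thesis
        using W(2) \<open>k \<in> K\<close> by blast
    qed
    obtain k0 k4 k6 where k: "k0 \<in> W" "near 6 0 (c k0 j)" "k4 \<in> W" "near 6 4 (c k4 j)"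
      "k6 \<in> W" "near 6 6 (c k6 j)"
      using near_z[of 0] near_z[of 4] near_z[of 6] by auto
    then have n: "c k0 j = 0" "3 \<le> c k4 j" "c k4 j \<le> 5" "c k6 j = 6"
      using b by (auto simp: near_def)
    have "distinct [b, k0, k4, k6]"
      using n b by auto
    then have "card {b, k0, k4, k6} = 4"
      using distinct_card by fastforce
    moreover have "card {b, k0, k4, k6} \<le> card W"
      using W k b by (intro card_mono) auto
    ultimately show ?thesis by simp
  qed
  have "width i \<ge> card (centres (u j))"
  proof -
    have "width i = card (centres (u j)) * (\<Prod>l\<in>UNIV - {i} - {j}. card (centres (u l)))"
      using assms by (subst prod.remove[of _ j]) auto
    moreover have "1 \<le> (\<Prod>l\<in>UNIV - {i} - {j}. card (centres (u l)))"
    proof (rule prod_ge_1)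
      show "1 \<le> card (centres (u l))" for l
        using le_three_card_centres[of "u l"] by linarith
    qed
    ultimately show ?thesis by simp
  qed
  then have wid: "3 \<le> width i"
    using card_centres[of 6] assms by simp
  obtain b where b: "b \<in> K" "c b j = 1"
    using onto[of 1 j] assms by auto
  let ?a = "\<lambda>x. card (layer i x)"
  have ends: "3 \<le> ?a 0" "3 \<le> ?a (u i)"
    using wid card_first_layer[of i] card_last_layer[of i] by linarith+
  have rest: "card X \<le> (\<Sum>x\<in>X. ?a x)" if "X \<subseteq> {0<..<u i}" for X
  proof -
    have "(\<Sum>x\<in>X. 1) \<le> (\<Sum>x\<in>X. ?a x)"
      using that by (intro sum_mono card_layer_pos) auto
    then show ?thesis by simp
  qed
  \<comment> \<open>The plain count \<open>3 + 3 + (u i - 1)\<close> is one short. The missing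
    member is gained in whichever end layer or inner triple contains \<open>b\<close>.\<close>
  consider "c b i = 0" | "c b i = u i" | "0 < c b i" "c b i < u i"
    using le_u[OF b(1), of i] by linarith
  then show ?thesis
  proof cases
    case 1
    have "4 \<le> ?a 0"
      by (rule four[of _ 0 b]) (use 1 b in \<open>auto simp: near_def layer_def finite_K\<close>)
    then show ?thesis
      using card_K_split[of i] rest[of "{0<..<u i}"] ends assms by simp
  next
    case 2
    have "4 \<le> ?a (u i)"
      by (rule four[of _ "u i" b]) (use 2 b in \<open>auto simp: near_def layer_def finite_K\<close>)
    then show ?thesis
      using card_K_split[of i] rest[of "{0<..<u i}"] ends assms by simp
  next
    case 3
    \<comment> \<open>Near the upper end the triple is moved left, to the last three inner layers,
      so that it still contains the layer of \<open>b\<close>.\<close>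
    define x where "x = (if c b i + 2 < u i then c b i else u i - 3)"
    have x: "0 < x" "x + 2 < u i" "x \<le> c b i" "c b i \<le> x + 2"
      using 3 assms by (auto simp: x_def)
    have "4 \<le> card (layer i x \<union> layer i (x + 1) \<union> layer i (x + 2))"
    proof (rule four[of _ "x + 1" b])
      show "b \<in> layer i x \<union> layer i (x + 1) \<union> layer i (x + 2)"
        using x b by (auto simp: layer_def)
    qed (use x b in \<open>auto simp: near_def layer_def finite_K\<close>)
    then have tri: "4 \<le> ?a x + ?a (x + 1) + ?a (x + 2)"
      by (simp only: card_triple)
    define R where "R = {0<..<u i} - {x, x + 1, x + 2}"
    have split: "{0<..<u i} = {x, x + 1, x + 2} \<union> R"
      using x by (auto simp: R_def)
    have "(\<Sum>y\<in>{0<..<u i}. ?a y) = ?a x + ?a (x + 1) + ?a (x + 2) + (\<Sum>y\<in>R. ?a y)"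
      unfolding split by (subst sum.union_disjoint) (auto simp: R_def)
    moreover have "card R = u i - 1 - 3"
      unfolding R_def using x by (subst card_Diff_subset) auto
    moreover have "card R \<le> (\<Sum>y\<in>R. ?a y)"
      by (rule rest) (auto simp: R_def)
    ultimately show ?thesis
      using card_K_split[of i] tri ends assms by simp
  qed
qed

text \<open>Counting is done along a direction \<open>i\<close> with \<open>u i\<close> largest. If
  at least two other directions have positive \<open>u\<close>, the product \<open>width i\<close>
  outgrows the sum; exactly one such direction is the delicate case.\<close>

theorem sum_le_card: "(\<Sum>i\<in>UNIV. u i) \<le> card K"
proof -
  obtain i where max: "\<And>j. u j \<le> u i"
  proof -
    have "Max (range u) \<in> range u" by (rule Max_in) auto
    then obtain i where "Max (range u) = u i" by blast
    then show ?thesis using that[of i] by (metis Max_ge finite finite_imageI rangeI)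
  qed
  show ?thesis
  proof (cases "u i = 0")
    case True
    then have "u j = 0" for j using max[of j] by simp
    then show ?thesis by simp
  next
    case False
    then have pos: "u i > 0" by simp
    define w where "w j = card (centres (u j)) - 1" for j
    have w: "card (centres (u j)) = 1 + w j" "u j \<le> 3 * w j" for j
      using le_three_card_centres[of "u j"] by (auto simp: w_def)
    have w0: "w j = 0" if "u j = 0" for j
      using that by (simp add: w_def)
    have width: "width i = (\<Prod>j\<in>UNIV - {i}. 1 + w j)"
      by (simp add: w)
    have sum_u: "(\<Sum>j\<in>UNIV. u j) = u i + (\<Sum>j\<in>UNIV - {i}. u j)"
      by (simp add: sum.remove)
    have sum_le: "(\<Sum>j\<in>UNIV - {i}. u j) \<le> 3 * (\<Sum>j\<in>UNIV - {i}. w j)"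
      unfolding sum_distrib_left by (rule sum_mono) (rule w)
    consider "\<And>j. j \<noteq> i \<Longrightarrow> u j = 0"
      | j where "j \<noteq> i" "u j > 0" "\<And>k. k \<noteq> i \<Longrightarrow> k \<noteq> j \<Longrightarrow> u k = 0"
      | j k where "j \<noteq> i" "k \<noteq> i" "j \<noteq> k" "u j > 0" "u k > 0"
      by (metis gr0I)
    then show ?thesis
    proof cases
      case 1
      then have "(\<Sum>j\<in>UNIV. u j) = u i" by (simp add: sum_u)
      moreover have "1 \<le> width i"
        unfolding width by (rule prod_ge_1) simp
      ultimately show ?thesis using card_K_ge[OF pos] by linarith
    next
      case (2 j)
      have sj: "(\<Sum>j\<in>UNIV. u j) = u i + u j"
        unfolding sum_u using 2 by (subst sum.remove[of _ j]) auto
      have wj: "width i = 1 + w j"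
        unfolding width using 2 w0 by (subst prod.remove[of _ j]) auto
      have card_j: "1 + w j = (u j - 1) div 3 + 2"
        using card_centres[OF 2(2)] w(1)[of j] by simp
      show ?thesis
      proof (cases "u j \<le> 2 * width i - 1")
        case True
        then show ?thesis using card_K_ge[OF pos] sj wj by linarith
      next
        \<comment> \<open>Now \<open>2 * w j + 2 \<le> u j \<le> 3 * w j\<close>, hence
          \<open>w j \<ge> 2\<close>, and \<open>w j = 2\<close> leaves only \<open>u j = 6\<close>,
          the case of \<open>card_K_ge_six\<close>.\<close>
        case F: False
        have uw: "u j \<le> 3 * w j" by (rule w)
        have "w j \<ge> 2" using F uw wj by linarith
        show ?thesis
        proof (cases "w j = 2")
          case True
          then have "u j = 6" using F uw wj by linarith
          then show ?thesis using card_K_ge_six[of i j] 2(1) max[of j] sj by auto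
        next
          case False
          \<comment> \<open>The surplus of a triple is \<open>width i - 3 = e + 1\<close> and
            \<open>g\<close> is the number of triples; since \<open>u j \<le> u i\<close>, it is at
            least \<open>w j - 1 = e + 2\<close>.\<close>
          define e g where "e = w j - 3" and "g = (u i - 1) div 3"
          have wje: "w j = e + 3" using False \<open>w j \<ge> 2\<close> by (simp add: e_def)
          have "(u j - 1) div 3 \<le> g"
            unfolding g_def using max[of j] by (intro div_le_mono) simp
          then have g: "e + 2 \<le> g" using card_j wje by simp
          have "2 * width i + (u i - 1) + (width i - 3) * g \<le> card K"
            unfolding g_def using pos wj wje by (intro card_K_ge_triples) auto
          moreover have "(e + 1) * (e + 2) \<le> (width i - 3) * g"
            using g by (intro mult_le_mono) (auto simp: wj wje)
          moreover have "(e + 1) * (e + 2) \<ge> e + 2" by simp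
          ultimately show ?thesis using sj uw pos wj wje by linarith
        qed
      qed
    next
      case (3 j k)
      have wpos: "w j > 0" "w k > 0" using w(2)[of j] w(2)[of k] 3 by auto
      have "2 * (\<Sum>j\<in>UNIV - {i}. w j) \<le> width i"
        unfolding width by (rule prod_Suc_ge_double_sum[of _ j k]) (use 3 wpos in auto)
      moreover have "w j \<le> (\<Sum>j\<in>UNIV - {i}. w j)"
        using 3 by (intro member_le_sum) auto
      ultimately show ?thesis
        using card_K_ge[OF pos] sum_le wpos unfolding sum_u by linarith
    qed
  qed
qed

end

section \<open>Families of bricks admitting no further brick\<close>

text \<open>A brick is handled as its pair of lower and upper corners, which turns inclusion and
  intersection into coordinatewise integer comparisons.\<close>

type_synonym 'd box = "('d \<Rightarrow> int) \<times> ('d \<Rightarrow> int)"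

definition sub_box :: "'d box \<Rightarrow> 'd box \<Rightarrow> bool" where
  "sub_box X Y \<longleftrightarrow> (\<forall>i. fst Y i \<le> fst X i \<and> snd X i \<le> snd Y i)"

text \<open>Boxes are closed: sharing a boundary point already counts as meeting.\<close>

definition meets :: "'d box \<Rightarrow> 'd box \<Rightarrow> bool" where
  "meets X Y \<longleftrightarrow> (\<forall>i. fst X i \<le> snd Y i \<and> fst Y i \<le> snd X i)"

definition boxes :: "'d box \<Rightarrow> 'd box set" where
  "boxes M = {X. (\<forall>i. fst X i < snd X i) \<and> sub_box X M}"

lemma sub_box_imp_meets:
  assumes "sub_box X Y" "\<And>i. fst X i < snd X i"
  shows "meets X Y"
  unfolding meets_def
proof
  fix i
  show "fst X i \<le> snd Y i \<and> fst Y i \<le> snd X i"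
    using assms(1)[unfolded sub_box_def, rule_format, of i] assms(2)[of i] by linarith
qed

lemma sub_box_trans: "sub_box X Y \<Longrightarrow> sub_box Y Z \<Longrightarrow> sub_box X Z"
  unfolding sub_box_def by (meson order_trans)

text \<open>The image under negation of all coordinates. It turns statements about lower ends into
  statements about upper ends.\<close>

definition reflect :: "'d box \<Rightarrow> 'd box" where
  "reflect X = (\<lambda>i. - snd X i, \<lambda>i. - fst X i)"

lemma reflect_reflect [simp]: "reflect (reflect X) = X"
  by (simp add: reflect_def)

lemma reflect_eq_iff [simp]: "reflect X = reflect Y \<longleftrightarrow> X = Y"
  by (metis reflect_reflect)

lemma sub_box_reflect [simp]: "sub_box (reflect X) (reflect Y) \<longleftrightarrow> sub_box X Y"
  by (auto simp: sub_box_def reflect_def)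

lemma meets_reflect [simp]: "meets (reflect X) (reflect Y) \<longleftrightarrow> meets X Y"
  by (auto simp: meets_def reflect_def)

lemma reflect_in_boxes [simp]: "reflect X \<in> boxes (reflect M) \<longleftrightarrow> X \<in> boxes M"
  unfolding boxes_def mem_Collect_eq sub_box_reflect by (simp add: reflect_def)

text \<open>Only the open extent of a member covers a cut, so a cut along a face of a member may
  still be uncovered.\<close>

definition uncovered :: "'d box \<Rightarrow> 'd box set \<Rightarrow> 'd \<Rightarrow> int set" where
  "uncovered M F i = {t. fst M i < t \<and> t < snd M i \<and> (\<forall>B\<in>F. t \<le> fst B i \<or> snd B i \<le> t)}"

lemma finite_uncovered [simp]: "finite (uncovered M F i)"
  by (rule finite_subset[of _ "{fst M i..snd M i}"]) (auto simp: uncovered_def)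

lemma uncovered_reflect: "uncovered (reflect M) (reflect ` F) i = uminus ` uncovered M F i"
proof -
  have "t \<in> uncovered (reflect M) (reflect ` F) i \<longleftrightarrow> - t \<in> uncovered M F i" for t
    by (auto simp: uncovered_def reflect_def)
  then have "uncovered (reflect M) (reflect ` F) i = uminus -` uncovered M F i"
    by blast
  also have "\<dots> = uminus ` uncovered M F i"
    by (force simp: image_iff)
  finally show ?thesis .
qed

lemma card_uncovered_reflect [simp]:
  "card (uncovered (reflect M) (reflect ` F) i) = card (uncovered M F i)"
  unfolding uncovered_reflect by (rule card_image) simp

text \<open>The part of \<open>M\<close> below the plane at height \<open>snd B i\<close>. Such
  members form the degenerate case, in which a cut need not have a member starting at it.\<close>

definition lower_half :: "'d box \<Rightarrow> 'd \<Rightarrow> 'd box \<Rightarrow> bool" where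
  "lower_half M i B \<longleftrightarrow> fst B = fst M \<and> (\<forall>j. j \<noteq> i \<longrightarrow> snd B j = snd M j)"

definition upper_half :: "'d box \<Rightarrow> 'd \<Rightarrow> 'd box \<Rightarrow> bool" where
  "upper_half M i B \<longleftrightarrow> snd B = snd M \<and> (\<forall>j. j \<noteq> i \<longrightarrow> fst B j = fst M j)"

lemma lower_half_reflect [simp]: "lower_half (reflect M) i (reflect B) \<longleftrightarrow> upper_half M i B"
  by (auto simp: lower_half_def upper_half_def reflect_def fun_eq_iff)

lemma upper_half_reflect [simp]: "upper_half (reflect M) i (reflect B) \<longleftrightarrow> lower_half M i B"
  using lower_half_reflect[of "reflect M" i "reflect B"] by simp

text \<open>Models the maximal proper members of a maximal system. By \<open>saturated\<close>, a
  further box either lies inside a member, where nothing more is demanded, or conflicts with a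
  member.\<close>

locale saturated_family =
  fixes M :: "'d::finite box" and F :: "'d box set"
  assumes finite_F: "finite F"
    and M_proper: "\<And>i. fst M i < snd M i"
    and F_boxes: "F \<subseteq> boxes M"
    and M_notin: "M \<notin> F"
    and disjoint: "\<And>X Y. X \<in> F \<Longrightarrow> Y \<in> F \<Longrightarrow> meets X Y \<Longrightarrow> X = Y"
    and saturated: "\<And>X. X \<in> boxes M \<Longrightarrow> X \<noteq> M \<Longrightarrow>
      (\<exists>B\<in>F. sub_box X B) \<or> (\<exists>B\<in>F. meets X B \<and> \<not> sub_box B X)"
begin

lemma F_lt: "B \<in> F \<Longrightarrow> fst B i < snd B i"
  and F_lower: "B \<in> F \<Longrightarrow> fst M i \<le> fst B i"
  and F_upper: "B \<in> F \<Longrightarrow> snd B i \<le> snd M i"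
  using F_boxes by (auto simp: boxes_def sub_box_def)

lemma uncovered_disj: "B \<in> F \<Longrightarrow> t \<in> uncovered M F i \<Longrightarrow> t \<le> fst B i \<or> snd B i \<le> t"
  by (auto simp: uncovered_def)

lemma saturated_reflect: "saturated_family (reflect M) (reflect ` F)"
proof
  show "(\<exists>B\<in>reflect ` F. sub_box X B) \<or> (\<exists>B\<in>reflect ` F. meets X B \<and> \<not> sub_box B X)"
    if "X \<in> boxes (reflect M)" "X \<noteq> reflect M" for X
  proof -
    have "reflect X \<in> boxes M" "reflect X \<noteq> M"
      using that by (metis reflect_in_boxes reflect_reflect)+
    from saturated[OF this] show ?thesis
      by (metis image_eqI meets_reflect sub_box_reflect reflect_reflect)
  qed
  show "fst (reflect M) i < snd (reflect M) i" for i
    by (simp add: reflect_def M_proper)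
  show "X = Y" if "X \<in> reflect ` F" "Y \<in> reflect ` F" "meets X Y" for X Y
    using that disjoint by fastforce
  show "reflect M \<notin> reflect ` F"
    using M_notin by (metis imageE reflect_eq_iff)
  show "reflect ` F \<subseteq> boxes (reflect M)"
    using F_boxes reflect_in_boxes by blast
qed (simp add: finite_F)

text \<open>\<open>B\<close> covers all cuts in the other directions and all cuts below its upper
  face \<open>?t\<close>. If there is room beyond \<open>?t + 1\<close>, the slab there must itself
  be a member, so at most the cuts \<open>?t\<close> and \<open>?t + 1\<close> are
  uncovered.\<close>

lemma sum_uncovered_le_lower_half:
  assumes B: "B \<in> F" "lower_half M i B"
  shows "(\<Sum>j\<in>UNIV. card (uncovered M F j)) \<le> card F"
proof -
  let ?t = "snd B i"
  have eq: "fst B = fst M" "\<And>j. j \<noteq> i \<Longrightarrow> snd B j = snd M j"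
    using B by (auto simp: lower_half_def)
  have lt: "?t < snd M i"
  proof (rule ccontr)
    assume "\<not> ?t < snd M i"
    then have "snd B j = snd M j" for j
      using eq(2)[of j] F_upper[OF B(1), of i] by (cases "j = i") auto
    then have "B = M" using eq(1) by (auto simp: prod_eq_iff fun_eq_iff)
    then show False using B M_notin by simp
  qed
  have unc_i: "s = ?t \<or> ?t < s" "s < snd M i" if "s \<in> uncovered M F i" for s
    using that uncovered_disj[OF B(1) that] eq by (auto simp: uncovered_def)
  have "uncovered M F j = {}" if "j \<noteq> i" for j
    using uncovered_disj[OF B(1), of _ j] eq that by (force simp: uncovered_def)
  then have sum: "(\<Sum>j\<in>UNIV. card (uncovered M F j)) = card (uncovered M F i)"
    by (subst sum.remove[of _ i]) auto
  show ?thesis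
  proof (cases "snd M i = ?t + 1")
    case True
    then have "uncovered M F i \<subseteq> {?t}"
      using unc_i by force
    then have "card (uncovered M F i) \<le> card {?t}"
      by (intro card_mono) auto
    moreover have "card {B} \<le> card F"
      using B finite_F by (intro card_mono) auto
    ultimately show ?thesis using sum by simp
  next
    case False
    \<comment> \<open>The slab starts at \<open>?t + 1\<close> because at \<open>?t\<close> it would
      touch \<open>B\<close>.\<close>
    define X where "X = ((fst M)(i := ?t + 1), snd M)"
    have X: "X \<in> boxes M" "X \<noteq> M"
      using lt False M_proper[of i] M_proper F_lt[OF B(1), of i] eq
      by (auto simp: X_def boxes_def sub_box_def prod_eq_iff fun_eq_iff)
    have sub: "sub_box B' X" if "B' \<in> F" "meets X B'" for B'
    proof -
      have "B' \<noteq> B" using that by (auto simp: meets_def X_def dest!: spec[of _ i])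
      then have "\<not> meets B B'" using disjoint[OF B(1) that(1)] by blast
      then obtain j where j: "snd B' j < fst B j \<or> snd B j < fst B' j"
        by (auto simp: meets_def not_le)
      have "j = i"
        using j eq F_lower[OF that(1), of j] F_upper[OF that(1), of j] F_lt[OF that(1), of j]
        by force
      then have "?t < fst B' i"
        using j eq F_lower[OF that(1), of j] F_lt[OF that(1), of j] by auto
      then show ?thesis
        using F_lower[OF that(1)] F_upper[OF that(1)] by (auto simp: sub_box_def X_def)
    qed
    from saturated[OF X] sub obtain B' where B': "B' \<in> F" "sub_box X B'"
      by blast
    then have "meets X B'"
      using X(1) by (intro sub_box_imp_meets) (auto simp: boxes_def)
    from sub[OF B'(1) this] B'(2) have "B' = X"
      by (auto simp: sub_box_def prod_eq_iff fun_eq_iff intro: antisym)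
    have unc: "uncovered M F i \<subseteq> {?t, ?t + 1}"
    proof
      fix s assume s: "s \<in> uncovered M F i"
      have "s \<le> ?t + 1"
        using uncovered_disj[OF B'(1) s] unc_i(2)[OF s] \<open>B' = X\<close> by (auto simp: X_def)
      then show "s \<in> {?t, ?t + 1}"
        using unc_i(1)[OF s] by auto
    qed
    have "card (uncovered M F i) \<le> card {?t, ?t + 1}"
      using unc by (intro card_mono) auto
    moreover have "B \<noteq> X"
    proof
      assume "B = X"
      then have "fst B i = ?t + 1" unfolding X_def by (metis fst_conv fun_upd_same)
      then show False using F_lt[OF B(1), of i] by simp
    qed
    then have "card {?t, ?t + 1} = card {B, X}"
      by simp
    moreover have "card {B, X} \<le> card F"
      using B B' \<open>B' = X\<close> finite_F by (intro card_mono) auto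
    ultimately show ?thesis using sum by linarith
  qed
qed

lemma sum_uncovered_le_upper_half:
  assumes "B \<in> F" "upper_half M i B"
  shows "(\<Sum>j\<in>UNIV. card (uncovered M F j)) \<le> card F"
proof -
  interpret R: saturated_family "reflect M" "reflect ` F"
    by (rule saturated_reflect)
  have "card (reflect ` F) = card F"
    by (rule card_image) (simp add: inj_on_def)
  then show ?thesis
    using R.sum_uncovered_le_lower_half[of "reflect B" i] assms by simp
qed

text \<open>The part of \<open>M\<close> below \<open>t\<close> fits into no member, so saturation
  yields a member that meets it and sticks out of it. As \<open>t\<close> is uncovered, this member
  starts exactly at \<open>t\<close>.\<close>

lemma ex_starting_at:
  assumes t: "t \<in> uncovered M F i" and nd: "\<And>B. B \<in> F \<Longrightarrow> \<not> lower_half M i B"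
  shows "\<exists>B\<in>F. fst B i = t"
proof -
  define X where "X = (fst M, (snd M)(i := t))"
  have t': "fst M i < t" "t < snd M i" using t by (auto simp: uncovered_def)
  have X: "X \<in> boxes M" "X \<noteq> M"
    using t' M_proper by (auto simp: X_def boxes_def sub_box_def prod_eq_iff fun_eq_iff)
  have "\<not> sub_box X B" if "B \<in> F" for B
  proof
    assume "sub_box X B"
    then have "fst B j = fst M j" "j \<noteq> i \<Longrightarrow> snd B j = snd M j" for j
      using F_lower[OF that, of j] F_upper[OF that, of j]
      by (auto simp: sub_box_def X_def dest!: spec[of _ j])
    then show False using nd[OF that] by (auto simp: lower_half_def fun_eq_iff)
  qed
  with saturated[OF X] obtain B where B: "B \<in> F" "meets X B" "\<not> sub_box B X"
    by blast
  then have "fst B i \<le> t" "t < snd B i"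
    using F_lower[OF B(1)] F_upper[OF B(1)]
    by (auto simp: meets_def sub_box_def X_def split: if_splits dest!: spec[of _ i])
  then show ?thesis
    using uncovered_disj[OF B(1) t] B(1) by force
qed

text \<open>Otherwise a member starting at \<open>t\<close> could be extended down to the face of
  \<open>M\<close>: an obstructing member would have to lie below it without touching it, and a gap
  of width 1 has no room for that.\<close>

lemma first_layer_thick:
  assumes t: "t \<in> uncovered M F i"
    and nd: "\<And>B. B \<in> F \<Longrightarrow> \<not> lower_half M i B" "\<And>B. B \<in> F \<Longrightarrow> \<not> upper_half M i B"
  shows "fst M i + 1 < t"
proof (rule ccontr)
  assume "\<not> fst M i + 1 < t"
  then have teq: "t = fst M i + 1" using t by (auto simp: uncovered_def)
  obtain B where B: "B \<in> F" "fst B i = t"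
    using ex_starting_at[OF t nd(1)] by blast
  define X where "X = ((fst B)(i := fst M i), snd B)"
  have X: "X \<in> boxes M"
    using F_lt[OF B(1)] F_lower[OF B(1)] F_upper[OF B(1)] B(2) teq
    by (auto simp: X_def boxes_def sub_box_def) (metis F_lt less_trans zless_add1_eq)
  have "X \<noteq> M"
  proof
    assume "X = M"
    then have "snd B = snd M" "(fst B)(i := fst M i) = fst M"
      by (metis X_def fst_conv snd_conv)+
    then show False
      using nd(2)[OF B(1)] unfolding upper_half_def by (metis fun_upd_other)
  qed
  have BX: "sub_box B X" using B teq by (auto simp: sub_box_def X_def)
  have "\<not> sub_box X B'" if "B' \<in> F" for B'
  proof
    assume s: "sub_box X B'"
    then have "meets B B'"
      using BX F_lt[OF B(1)] by (blast intro: sub_box_imp_meets sub_box_trans)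
    then have "B = B'" using disjoint B that by blast
    then show False using s B teq by (auto simp: sub_box_def X_def split: if_splits)
  qed
  with saturated[OF X \<open>X \<noteq> M\<close>] obtain B' where B': "B' \<in> F" "meets X B'" "\<not> sub_box B' X"
    by blast
  then have "\<not> meets B B'" using disjoint[OF B(1) B'(1)] BX by blast
  then obtain j where "snd B' j < fst B j \<or> snd B j < fst B' j"
    by (auto simp: meets_def not_le)
  then have "snd B' i < fst B i"
    using B'(2) by (cases "j = i") (auto simp: meets_def X_def not_le dest!: spec[of _ j])
  then show False
    using F_lower[OF B'(1), of i] F_lt[OF B'(1), of i] B(2) teq by linarith
qed

lemma last_layer_thick:
  assumes t: "t \<in> uncovered M F i"
    and nd: "\<And>B. B \<in> F \<Longrightarrow> \<not> lower_half M i B" "\<And>B. B \<in> F \<Longrightarrow> \<not> upper_half M i B"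
  shows "t + 1 < snd M i"
proof -
  interpret R: saturated_family "reflect M" "reflect ` F"
    by (rule saturated_reflect)
  have "- t \<in> uncovered (reflect M) (reflect ` F) i"
    using t by (simp add: uncovered_reflect)
  then have "fst (reflect M) i + 1 < - t"
    using nd by (intro R.first_layer_thick) auto
  then show ?thesis by (simp add: reflect_def)
qed

text \<open>Both alternatives of \<open>saturated\<close> imply meeting; \<open>big\<close> ensures
  that the unit cube differs from \<open>M\<close>.\<close>

lemma ex_meeting_unit_box:
  assumes x: "\<And>i. fst M i \<le> x i" "\<And>i. x i < snd M i" and big: "\<exists>i. fst M i + 1 < snd M i"
  shows "\<exists>B\<in>F. \<forall>i. fst B i \<le> x i + 1 \<and> x i \<le> snd B i"
proof -
  let ?X = "(x, \<lambda>i. x i + 1)"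
  have "?X \<in> boxes M"
    using x by (auto simp: boxes_def sub_box_def add1_zle_eq)
  moreover have "?X \<noteq> M" using big by auto
  ultimately obtain B where B: "B \<in> F" "meets ?X B \<or> sub_box ?X B"
    using saturated by blast
  moreover have "sub_box ?X B \<Longrightarrow> meets ?X B"
    by (rule sub_box_imp_meets) auto
  ultimately show ?thesis by (auto simp: meets_def)
qed

end

section \<open>Ranks in a finite set of integers\<close>

lemma ex_card_less_eq:
  fixes U :: "int set"
  assumes "finite U" "l < card U"
  shows "\<exists>t\<in>U. card {s\<in>U. s < t} = l"
proof -
  let ?f = "\<lambda>t. card {s\<in>U. s < t}"
  have mono: "?f s < ?f t" if "s \<in> U" "s < t" for s t
    using that assms(1) by (intro psubset_card_mono) auto
  have "inj_on ?f U"
  proof (rule inj_onI)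
    fix s t assume "s \<in> U" "t \<in> U" "?f s = ?f t"
    then show "s = t" using mono[of s t] mono[of t s] by linarith
  qed
  then have "card (?f ` U) = card U" by (rule card_image)
  moreover have "?f ` U \<subseteq> {..<card U}"
  proof
    fix n assume "n \<in> ?f ` U"
    then obtain t where "t \<in> U" "n = ?f t" by blast
    then have "{s\<in>U. s < t} \<subset> U" by blast
    then show "n \<in> {..<card U}"
      using \<open>n = ?f t\<close> psubset_card_mono[OF assms(1)] by blast
  qed
  ultimately have "?f ` U = {..<card U}"
    by (intro card_subset_eq) auto
  then have "l \<in> ?f ` U" using assms(2) by blast
  then show ?thesis by blast
qed

lemma card_le_eq_Suc_card_less:
  fixes U :: "int set"
  assumes "finite U" "t \<in> U"
  shows "card {s\<in>U. s \<le> t} = Suc (card {s\<in>U. s < t})"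
proof -
  have "{s\<in>U. s \<le> t} = insert t {s\<in>U. s < t}" using assms by auto
  then show ?thesis using assms by simp
qed

context saturated_family
begin

text \<open>The counting theorem is applied to the layers between uncovered cuts, each numbered by
  the uncovered cuts below it.\<close>

lemma sum_uncovered_le_nondegenerate:
  assumes nd: "\<And>i B. B \<in> F \<Longrightarrow> \<not> lower_half M i B" "\<And>i B. B \<in> F \<Longrightarrow> \<not> upper_half M i B"
  shows "(\<Sum>i\<in>UNIV. card (uncovered M F i)) \<le> card F"
proof (cases "\<forall>i. uncovered M F i = {}")
  case True
  then show ?thesis by simp
next
  case False
  then obtain i t where "t \<in> uncovered M F i" by blast
  then have "fst M i + 1 < snd M i" by (simp add: uncovered_def)
  then have big: "\<exists>i. fst M i + 1 < snd M i" by blast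
  let ?U = "uncovered M F"
  define c where "c B i = card {s\<in>?U i. s \<le> fst B i}" for B :: "'d box" and i
  \<comment> \<open>No uncovered cut passes through \<open>B\<close>, so its upper face gives the
    same layer number as its lower face.\<close>
  have c_eq: "c B i = card {s\<in>?U i. s < snd B i}" if "B \<in> F" for B i
  proof -
    have "{s\<in>?U i. s \<le> fst B i} = {s\<in>?U i. s < snd B i}"
      using uncovered_disj[OF that, of _ i] F_lt[OF that, of i] by fastforce
    then show ?thesis by (simp add: c_def)
  qed
  have c_le: "c B i \<le> card (?U i)" for B i
    unfolding c_def by (rule card_mono) auto
  have bounds: "card {s\<in>?U i. s < x i} \<le> c B i" "c B i \<le> card {s\<in>?U i. s \<le> x i + 1}"
    if "B \<in> F" "fst B i \<le> x i + 1" "x i \<le> snd B i" for B i x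
  proof -
    have "{s\<in>?U i. s < x i} \<subseteq> {s\<in>?U i. s < snd B i}" "{s\<in>?U i. s \<le> fst B i} \<subseteq> {s\<in>?U i. s \<le> x i + 1}"
      using that by auto
    then have "card {s\<in>?U i. s < x i} \<le> card {s\<in>?U i. s < snd B i}"
      "card {s\<in>?U i. s \<le> fst B i} \<le> card {s\<in>?U i. s \<le> x i + 1}"
      by (simp_all add: card_mono)
    then show "card {s\<in>?U i. s < x i} \<le> c B i" "c B i \<le> card {s\<in>?U i. s \<le> x i + 1}"
      by (simp_all only: c_eq[OF that(1), symmetric] c_def[symmetric])
  qed
  have thick: "fst M i + 1 < s" "s + 1 < snd M i" if "s \<in> ?U i" for s i
    using first_layer_thick[OF that nd] last_layer_thick[OF that nd] by auto
  interpret dense_profiles F c "\<lambda>i. card (?U i)"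
  proof
    show "finite F" by (rule finite_F)
    show "c B i \<le> card (?U i)" for B i by (rule c_le)
    show dense: "\<exists>B\<in>F. \<forall>i. near (card (?U i)) (p i) (c B i)" if p: "\<And>i. p i \<le> card (?U i)" for p
    proof -
      \<comment> \<open>\<open>P i x\<close> forces every member that meets
        \<open>[x, x + 1]\<close> in direction \<open>i\<close> into a layer near
        \<open>p i\<close>, by \<open>bounds\<close>.\<close>
      define P where "P i x \<longleftrightarrow> fst M i \<le> x \<and> x < snd M i \<and>
          (p i = 0 \<longrightarrow> card {s\<in>?U i. s \<le> x + 1} = 0) \<and>
          (p i = card (?U i) \<longrightarrow> card {s\<in>?U i. s < x} = card (?U i)) \<and>
          p i \<le> card {s\<in>?U i. s < x} + 1 \<and> card {s\<in>?U i. s \<le> x + 1} \<le> p i + 1" for i x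
      have "\<exists>x. P i x" for i
      proof -
        \<comment> \<open>The witness is the first unit interval of \<open>M\<close>, the last one,
          or the one starting at the cut between layers \<open>p i - 1\<close> and
          \<open>p i\<close>. The first two work because the outermost layers are thick.\<close>
        consider "p i = 0" | "p i = card (?U i)" "p i > 0" | "0 < p i" "p i < card (?U i)"
          using p[of i] by linarith
        then show ?thesis
        proof cases
          case 1
          have "\<not> s \<le> fst M i + 1" if "s \<in> ?U i" for s
            using thick(1)[OF that] by linarith
          then have "{s\<in>?U i. s \<le> fst M i + 1} = {}"
            by blast
          then have "card {s\<in>?U i. s \<le> fst M i + 1} = 0"
            by (simp only: card.empty)
          moreover have "card {s\<in>?U i. s < fst M i} \<le> card (?U i)"
            by (rule card_mono) auto
          ultimately have "P i (fst M i)"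
            using 1 M_proper[of i] unfolding P_def by (intro conjI impI) linarith+
          then show ?thesis by blast
        next
          case 2
          have "s < snd M i - 1" if "s \<in> ?U i" for s
            using thick(2)[OF that] by linarith
          then have "{s\<in>?U i. s < snd M i - 1} = ?U i"
            by blast
          moreover have "card {s\<in>?U i. s \<le> snd M i - 1 + 1} \<le> card (?U i)"
            by (rule card_mono) auto
          moreover have "fst M i \<le> snd M i - 1" "snd M i - 1 < snd M i"
            using M_proper[of i] by linarith+
          ultimately have "P i (snd M i - 1)"
            using 2 unfolding P_def by (intro conjI impI) simp_all
          then show ?thesis by blast
        next
          case 3
          then have "p i - 1 < card (?U i)" by linarith
          from ex_card_less_eq[OF finite_uncovered this]
          obtain t where t: "t \<in> ?U i" "card {s\<in>?U i. s < t} = p i - 1"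
            by blast
          have "{s\<in>?U i. s \<le> t + 1} \<subseteq> insert (t + 1) {s\<in>?U i. s \<le> t}"
            by auto
          then have "card {s\<in>?U i. s \<le> t + 1} \<le> card (insert (t + 1) {s\<in>?U i. s \<le> t})"
            by (rule card_mono[rotated]) simp
          also have "\<dots> \<le> Suc (card {s\<in>?U i. s \<le> t})"
            by (simp add: card_insert_if)
          also have "\<dots> = p i + 1"
            using t 3 by (simp add: card_le_eq_Suc_card_less)
          finally have "card {s\<in>?U i. s \<le> t + 1} \<le> p i + 1" .
          moreover have "fst M i \<le> t" "t < snd M i"
            using thick[OF t(1)] by linarith+
          ultimately have "P i t"
            using t(2) 3 unfolding P_def by (intro conjI impI) linarith+
          then show ?thesis by blast
        qed
      qed
      then obtain x where "\<And>i. P i (x i)"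
        by metis
      then have x: "\<And>i. fst M i \<le> x i" "\<And>i. x i < snd M i"
          "\<And>i. p i = 0 \<Longrightarrow> card {s\<in>?U i. s \<le> x i + 1} = 0"
          "\<And>i. p i = card (?U i) \<Longrightarrow> card {s\<in>?U i. s < x i} = card (?U i)"
          "\<And>i. p i \<le> card {s\<in>?U i. s < x i} + 1" "\<And>i. card {s\<in>?U i. s \<le> x i + 1} \<le> p i + 1"
        unfolding P_def by blast+
      obtain B where B: "B \<in> F" "\<And>i. fst B i \<le> x i + 1" "\<And>i. x i \<le> snd B i"
        using ex_meeting_unit_box[OF x(1,2) big] by blast
      have "near (card (?U i)) (p i) (c B i)" for i
        using bounds[of B i x, OF B(1) B(2)[of i] B(3)[of i]] x(3-6)[of i] c_le[of B i]
        unfolding near_def by (intro conjI impI) linarith+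
      then show ?thesis using B(1) by blast
    qed
    show "\<exists>B\<in>F. c B i = l" if "l \<le> card (?U i)" for i l
    proof (cases l)
      case 0
      then show ?thesis
        using dense[of "\<lambda>_. 0"] by (force simp: near_def)
    next
      case (Suc n)
      then have "n < card (?U i)" using that by linarith
      from ex_card_less_eq[OF finite_uncovered this]
      obtain t where t: "t \<in> ?U i" "card {s\<in>?U i. s < t} = n"
        by blast
      \<comment> \<open>A member starting at the cut of rank \<open>n\<close> has exactly
        \<open>n + 1\<close> uncovered cuts at or below its lower face.\<close>
      obtain B where B: "B \<in> F" "fst B i = t"
        using ex_starting_at[OF t(1) nd(1)] by blast
      then have "c B i = l"
        using t Suc by (simp add: c_def card_le_eq_Suc_card_less)
      then show ?thesis using B by blast
    qed
  qed
  show ?thesis by (rule sum_le_card)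
qed

theorem sum_uncovered_le: "(\<Sum>i\<in>UNIV. card (uncovered M F i)) \<le> card F"
proof -
  consider B i where "B \<in> F" "lower_half M i B" | B i where "B \<in> F" "upper_half M i B"
    | "\<And>i B. B \<in> F \<Longrightarrow> \<not> lower_half M i B" "\<And>i B. B \<in> F \<Longrightarrow> \<not> upper_half M i B"
    by metis
  then show ?thesis
  proof cases
    case 1
    then show ?thesis by (rule sum_uncovered_le_lower_half)
  next
    case 2
    then show ?thesis by (rule sum_uncovered_le_upper_half)
  next
    case 3
    then show ?thesis by (rule sum_uncovered_le_nondegenerate)
  qed
qed

end

section \<open>Maximal systems\<close>

lemma sub_box_refl [simp]: "sub_box X X"
  by (simp add: sub_box_def)

lemma sub_box_antisym: "sub_box X Y \<Longrightarrow> sub_box Y X \<Longrightarrow> X = Y"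
  by (auto simp: sub_box_def prod_eq_iff fun_eq_iff intro: antisym)

lemma meets_mono: "meets X Y \<Longrightarrow> sub_box X X' \<Longrightarrow> sub_box Y Y' \<Longrightarrow> meets X' Y'"
  unfolding meets_def sub_box_def by (meson order_trans)

lemma meets_commute: "meets X Y \<longleftrightarrow> meets Y X"
  by (auto simp: meets_def)

lemma finite_boxes: "finite (boxes (M :: 'd::finite box))"
proof -
  let ?G = "PiE UNIV (\<lambda>i. {fst M i..snd M i})"
  have "boxes M \<subseteq> ?G \<times> ?G"
  proof
    fix X assume "X \<in> boxes M"
    then have "fst M i \<le> fst X i \<and> fst X i < snd X i \<and> snd X i \<le> snd M i" for i
      by (simp add: boxes_def sub_box_def)
    then have "fst X \<in> ?G" "snd X \<in> ?G"
      by (auto simp: PiE_UNIV_domain) (meson less_imp_le order_trans)+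
    then show "X \<in> ?G \<times> ?G" by (simp add: mem_Times_iff)
  qed
  moreover have "finite (?G \<times> ?G)"
    by (intro finite_cartesian_product finite_PiE) auto
  ultimately show ?thesis by (rule finite_subset)
qed

definition laminar :: "'d box \<Rightarrow> 'd box \<Rightarrow> bool" where
  "laminar X Y \<longleftrightarrow> sub_box X Y \<or> sub_box Y X \<or> \<not> meets X Y"

text \<open>Maximality is tested by adjoining one box at a time;
  \<open>maximal_brick_island_systems_eq\<close> identifies this with maximality under
  inclusion.\<close>

definition max_system :: "'d box \<Rightarrow> 'd box set \<Rightarrow> bool" where
  "max_system M H \<longleftrightarrow> H \<subseteq> boxes M \<and> (\<forall>X\<in>H. \<forall>Y\<in>H. laminar X Y) \<and>
     (\<forall>X\<in>boxes M. (\<forall>Y\<in>H. laminar X Y) \<longrightarrow> X \<in> H)"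

definition cuts :: "'d::finite box \<Rightarrow> nat" where
  "cuts M = (\<Sum>i\<in>UNIV. nat (snd M i - fst M i - 1))"

lemma max_system_top:
  assumes "max_system M H" "\<And>i. fst M i < snd M i"
  shows "M \<in> H"
proof -
  have "M \<in> boxes M" using assms(2) by (simp add: boxes_def)
  moreover have "laminar M X" if "X \<in> H" for X
    using assms(1) that unfolding max_system_def boxes_def laminar_def by blast
  ultimately show ?thesis using assms(1) unfolding max_system_def by blast
qed

lemma finite_max_system: "max_system M H \<Longrightarrow> finite (H :: 'd::finite box set)"
  unfolding max_system_def by (metis finite_boxes finite_subset)

text \<open>Members of \<open>H\<close> not inside \<open>B\<close> contain \<open>B\<close> or miss
  it, so they are compatible with every box inside \<open>B\<close>.\<close>

lemma max_system_restrict: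
  assumes H: "max_system M H" and B: "B \<in> H"
  shows "max_system B {X\<in>H. sub_box X B}"
  unfolding max_system_def
proof (intro conjI ballI impI)
  show "{X\<in>H. sub_box X B} \<subseteq> boxes B"
    using H by (auto simp: max_system_def boxes_def)
  show "laminar X Y" if "X \<in> {X\<in>H. sub_box X B}" "Y \<in> {X\<in>H. sub_box X B}" for X Y
    using that H by (auto simp: max_system_def)
  fix X assume X: "X \<in> boxes B" and comp: "\<forall>Y\<in>{X\<in>H. sub_box X B}. laminar X Y"
  have XB: "sub_box X B" using X by (simp add: boxes_def)
  have "sub_box B M" using B H by (auto simp: max_system_def boxes_def)
  then have "X \<in> boxes M" using X sub_box_trans[OF XB] by (simp add: boxes_def)
  moreover have "laminar X Y" if "Y \<in> H" for Y
  proof -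
    have "laminar Y B" using that B H by (simp add: max_system_def)
    then consider "sub_box Y B" | "sub_box B Y" | "\<not> meets Y B"
      by (auto simp: laminar_def)
    then show ?thesis
    proof cases
      case 1
      then show ?thesis using comp that by blast
    next
      case 2
      then show ?thesis using sub_box_trans[OF XB] by (simp add: laminar_def)
    next
      case 3
      then show ?thesis
        using meets_mono[of Y X Y B] XB by (auto simp: laminar_def meets_commute)
    qed
  qed
  ultimately have "X \<in> H" using H by (simp add: max_system_def)
  then show "X \<in> {X\<in>H. sub_box X B}" using XB by simp
qed

definition maximal_members :: "'d box \<Rightarrow> 'd box set \<Rightarrow> 'd box set" where
  "maximal_members M H = {X \<in> H - {M}. \<forall>Y\<in>H - {M}. sub_box X Y \<longrightarrow> Y = X}"

text \<open>Among the members above \<open>X\<close>, one with the most members of \<open>H\<close>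
  below it is maximal.\<close>

lemma ex_maximal_member:
  assumes "finite H" "X \<in> H - {M}"
  shows "\<exists>B\<in>maximal_members M H. sub_box X B"
proof -
  let ?S = "{Y\<in>H - {M}. sub_box X Y}"
  let ?f = "\<lambda>Y. card {Z\<in>H. sub_box Z Y}"
  have S: "finite ?S" using assms(1) by simp
  have "X \<in> ?S" using assms(2) by simp
  then have S_ne: "?S \<noteq> {}" by blast
  have "Max (?f ` ?S) \<in> ?f ` ?S"
    using S S_ne by (intro Max_in finite_imageI) (simp_all only: image_is_empty not_False_eq_True)
  then obtain B where B: "B \<in> ?S" "?f B = Max (?f ` ?S)"
    by (metis (no_types, lifting) imageE)
  have "Y = B" if "Y \<in> H - {M}" "sub_box B Y" for Y
  proof (rule ccontr)
    assume "Y \<noteq> B"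
    then have "\<not> sub_box Y B" using sub_box_antisym that by blast
    then have "{Z\<in>H. sub_box Z B} \<subset> {Z\<in>H. sub_box Z Y}"
      using that sub_box_trans[of _ B Y] by (auto intro: sub_box_refl)
    then have "?f B < ?f Y"
      using assms(1) by (intro psubset_card_mono) auto
    moreover have "Y \<in> ?S" using that B(1) sub_box_trans by blast
    then have "?f Y \<le> ?f B" unfolding B(2) using S by (intro Max_ge) auto
    ultimately show False by simp
  qed
  then have "B \<in> maximal_members M H"
    using B(1) unfolding maximal_members_def by blast
  then show ?thesis using B(1) by blast
qed

text \<open>A box violating \<open>saturated\<close> contains or misses each maximal member, hence
  is compatible with all of \<open>H\<close> and belongs to \<open>H\<close>. But then it lies below
  a maximal member.\<close>

lemma saturated_maximal_members:
  assumes H: "max_system M H" and M: "\<And>i. fst M i < snd (M :: 'd::finite box) i"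
  shows "saturated_family M (maximal_members M H)"
proof
  let ?F = "maximal_members M H"
  have fin: "finite H" by (rule finite_max_system[OF H])
  have FH: "?F \<subseteq> H" "M \<notin> ?F" by (auto simp: maximal_members_def)
  show "finite ?F" using fin FH finite_subset by blast
  show "?F \<subseteq> boxes M" using H FH by (auto simp: max_system_def)
  show "M \<notin> ?F" by fact
  show "X = Y" if "X \<in> ?F" "Y \<in> ?F" "meets X Y" for X Y
  proof -
    have "laminar X Y" using H FH that unfolding max_system_def by blast
    then show ?thesis using that by (auto simp: laminar_def maximal_members_def)
  qed
  show "(\<exists>B\<in>?F. sub_box X B) \<or> (\<exists>B\<in>?F. meets X B \<and> \<not> sub_box B X)"
    if X: "X \<in> boxes M" "X \<noteq> M" for X
  proof (rule ccontr)
    assume *: "\<not> ?thesis"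
    have "laminar X Y" if "Y \<in> H" for Y
    proof (cases "Y = M")
      case True
      then show ?thesis using X by (simp add: laminar_def boxes_def)
    next
      case False
      then obtain B where B: "B \<in> ?F" "sub_box Y B"
        using ex_maximal_member[OF fin] \<open>Y \<in> H\<close> by blast
      then consider "sub_box B X" | "\<not> meets X B" using * by blast
      then show ?thesis
      proof cases
        case 1
        then show ?thesis using sub_box_trans[OF B(2)] by (simp add: laminar_def)
      next
        case 2
        then show ?thesis
          using meets_mono[of X Y X B] B(2) by (auto simp: laminar_def)
      qed
    qed
    then have "X \<in> H - {M}" using H X by (simp add: max_system_def)
    then show False using ex_maximal_member[OF fin] * by blast
  qed
qed (rule M)

text \<open>Each cut of \<open>M\<close> is uncovered or is a cut of some \<open>B\<close> in
  \<open>F\<close>. The extra brick that the induction hypothesis grants each \<open>B\<close> pays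
  for the uncovered cuts, and \<open>M\<close> itself is the final \<open>+ 1\<close>.\<close>

lemma card_max_system_ge:
  assumes "max_system M H" "\<And>i. fst M i < snd (M :: 'd::finite box) i"
  shows "cuts M + 1 \<le> card H"
  using assms
proof (induction "card H" arbitrary: M H rule: less_induct)
  case less
  note H = less.prems(1)
  define F where "F = maximal_members M H"
  define S where "S B = {X\<in>H. sub_box X B}" for B
  have fin: "finite H" by (rule finite_max_system[OF H])
  have MH: "M \<in> H" using max_system_top[OF less.prems] .
  interpret saturated_family M F
    unfolding F_def by (rule saturated_maximal_members[OF less.prems])
  have FH: "F \<subseteq> H" by (auto simp: F_def maximal_members_def)
  have MS: "M \<notin> S B" if "B \<in> F" for B
    using that sub_box_antisym[of M B] F_boxes M_notin by (auto simp: S_def boxes_def)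
  have IH: "cuts B + 1 \<le> card (S B)" if "B \<in> F" for B
  proof (rule less.hyps)
    show "card (S B) < card H"
      using fin MH MS[OF that] by (intro psubset_card_mono) (auto simp: S_def)
    show "max_system B (S B)"
      unfolding S_def using H FH that by (intro max_system_restrict) auto
    show "fst B i < snd B i" for i using F_lt[OF that] .
  qed
  have dis: "S B \<inter> S B' = {}" if "B \<in> F" "B' \<in> F" "B \<noteq> B'" for B B'
  proof (rule ccontr)
    assume "S B \<inter> S B' \<noteq> {}"
    then obtain X where X: "X \<in> H" "sub_box X B" "sub_box X B'"
      by (auto simp: S_def)
    then have "meets X X"
      using H by (intro sub_box_imp_meets) (auto simp: max_system_def boxes_def)
    then have "meets B B'" using X meets_mono by blast
    then show False using disjoint that by blast
  qed
  have "(\<Sum>i\<in>UNIV. nat (snd M i - fst M i - 1)) \<le>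
      (\<Sum>i\<in>UNIV. card (uncovered M F i) + (\<Sum>B\<in>F. nat (snd B i - fst B i - 1)))"
  proof (rule sum_mono)
    fix i
    have "{fst M i<..<snd M i} \<subseteq> uncovered M F i \<union> (\<Union>B\<in>F. {fst B i<..<snd B i})"
      by (auto simp: uncovered_def not_le)
    then have "card {fst M i<..<snd M i} \<le> card (uncovered M F i \<union> (\<Union>B\<in>F. {fst B i<..<snd B i}))"
      using finite_F by (intro card_mono) auto
    also have "\<dots> \<le> card (uncovered M F i) + card (\<Union>B\<in>F. {fst B i<..<snd B i})"
      by (rule card_Un_le)
    also have "\<dots> \<le> card (uncovered M F i) + (\<Sum>B\<in>F. card {fst B i<..<snd B i})"
      using card_UN_le[OF finite_F] by (intro add_left_mono)
    finally show "nat (snd M i - fst M i - 1) \<le>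
        card (uncovered M F i) + (\<Sum>B\<in>F. nat (snd B i - fst B i - 1))"
      by (simp add: diff_diff_eq)
  qed
  also have "\<dots> = (\<Sum>i\<in>UNIV. card (uncovered M F i)) + (\<Sum>B\<in>F. cuts B)"
    unfolding cuts_def sum.distrib by (subst sum.swap) simp
  also have "\<dots> \<le> card F + (\<Sum>B\<in>F. cuts B)"
    using sum_uncovered_le by simp
  also have "\<dots> = (\<Sum>B\<in>F. cuts B + 1)"
    by (subst sum.distrib) simp
  also have "\<dots> \<le> (\<Sum>B\<in>F. card (S B))"
    by (intro sum_mono IH)
  also have "\<dots> = card (\<Union>B\<in>F. S B)"
    using finite_F fin dis by (subst card_UN_disjoint) (auto simp: S_def)
  finally have "cuts M + 1 \<le> card (\<Union>B\<in>F. S B) + 1"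
    by (simp add: cuts_def)
  also have "\<dots> = card (insert M (\<Union>B\<in>F. S B))"
    using finite_F fin MS by (subst card_insert_disjoint) (auto simp: S_def)
  also have "\<dots> \<le> card H"
    using fin MH by (intro card_mono) (auto simp: S_def)
  finally show ?case .
qed

text \<open>Shaving off a slab of thickness 1 adds one brick and removes one cut. No box lies
  strictly between \<open>N\<close> and \<open>M\<close>, and none fits into the slab without
  touching \<open>N\<close>, so maximality persists.\<close>

lemma ex_max_system_card:
  assumes "\<And>i. fst M i < snd (M :: 'd::finite box) i"
  shows "\<exists>H. max_system M H \<and> card H = cuts M + 1"
  using assms
proof (induction "cuts M" arbitrary: M rule: less_induct)
  case less
  note M = less.prems
  show ?case
  proof (cases "\<forall>i. snd M i = fst M i + 1")
    case True
    have "X = M" if "X \<in> boxes M" for X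
    proof (rule sub_box_antisym)
      show "sub_box X M" using that by (simp add: boxes_def)
      have "fst X i < snd X i" "fst M i \<le> fst X i" "snd X i \<le> snd M i" "snd M i = fst M i + 1" for i
        using that True by (auto simp: boxes_def sub_box_def)
      then have "fst X i \<le> fst M i \<and> snd M i \<le> snd X i" for i by (smt (verit))
      then show "sub_box M X" by (simp add: sub_box_def)
    qed
    then have "max_system M {M}"
      using M by (auto simp: max_system_def boxes_def laminar_def)
    moreover have "cuts M = 0" using True by (simp add: cuts_def)
    ultimately show ?thesis by (intro exI[of _ "{M}"]) simp
  next
    case False
    then obtain i where "snd M i \<noteq> fst M i + 1" by blast
    then have i: "fst M i + 1 < snd M i" using M[of i] by linarith
    define N where "N = (fst M, (snd M)(i := snd M i - 1))"
    have fstN: "fst N = fst M" and sndN: "snd N j = (if j = i then snd M i - 1 else snd M j)" for j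
      by (auto simp: N_def)
    have NM: "sub_box N M" by (auto simp: sub_box_def fstN sndN)
    have N: "fst N j < snd N j" for j
      using M[of j] i by (simp add: fstN sndN)
    have "N \<noteq> M" using sndN[of i] by auto
    have cuts: "cuts M = cuts N + 1"
    proof -
      have "cuts M = nat (snd M i - fst M i - 1) + (\<Sum>j\<in>UNIV - {i}. nat (snd M j - fst M j - 1))"
        unfolding cuts_def by (simp add: sum.remove)
      moreover have "cuts N = nat (snd N i - fst N i - 1) + (\<Sum>j\<in>UNIV - {i}. nat (snd N j - fst N j - 1))"
        unfolding cuts_def by (simp add: sum.remove)
      moreover have "(\<Sum>j\<in>UNIV - {i}. nat (snd N j - fst N j - 1)) = (\<Sum>j\<in>UNIV - {i}. nat (snd M j - fst M j - 1))"
        by (rule sum.cong) (auto simp: fstN sndN)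
      moreover have "nat (snd M i - fst M i - 1) = nat (snd N i - fst N i - 1) + 1"
        using i by (simp add: fstN sndN)
      ultimately show ?thesis by linarith
    qed
    then obtain H where H: "max_system N H" "card H = cuts N + 1"
      using less.hyps[of N] N by auto
    have HN: "X \<in> boxes N" if "X \<in> H" for X using H that by (auto simp: max_system_def)
    have "N \<in> H" using max_system_top[OF H(1) N] .
    have "max_system M (insert M H)"
      unfolding max_system_def
    proof (intro conjI ballI impI)
      have HM: "sub_box X M" if "X \<in> H" for X
        using HN[OF that] sub_box_trans[OF _ NM] by (auto simp: boxes_def)
      show "insert M H \<subseteq> boxes M"
        using HN HM M by (auto simp: boxes_def)
      show "laminar X Y" if "X \<in> insert M H" "Y \<in> insert M H" for X Y
        using that HM[of X] HM[of Y] H(1) sub_box_refl unfolding max_system_def laminar_def by blast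
      fix X assume X: "X \<in> boxes M" and comp: "\<forall>Y\<in>insert M H. laminar X Y"
      have X': "fst X j < snd X j" "fst M j \<le> fst X j" "snd X j \<le> snd M j" for j
        using X by (auto simp: boxes_def sub_box_def)
      have "laminar X N" using comp \<open>N \<in> H\<close> by simp
      then consider "sub_box X N" | "sub_box N X" | "\<not> meets X N" by (auto simp: laminar_def)
      then show "X \<in> insert M H"
      proof cases
        case 1
        then have "X \<in> boxes N" using X by (simp add: boxes_def)
        then show ?thesis using H(1) comp by (auto simp: max_system_def)
      next
        case 2
        then have eq: "fst X j = fst M j" "j \<noteq> i \<Longrightarrow> snd X j = snd M j" "snd M i - 1 \<le> snd X i" for j
          using X'(2,3)[of j] fstN sndN[of j] sndN[of i] by (auto simp: sub_box_def intro: antisym dest: spec[of _ j] spec[of _ i])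
        show ?thesis
        proof (cases "snd X i = snd M i")
          case True
          then have "snd X j = snd M j" for j using eq(2)[of j] by (cases "j = i") auto
          then have "X = M" using eq(1) by (simp add: prod_eq_iff fun_eq_iff)
          then show ?thesis by simp
        next
          case False
          then have "snd X i = snd M i - 1" using eq(3) X'(3)[of i] by linarith
          then have "snd X j = snd N j" for j using eq(2)[of j] by (simp add: sndN)
          then have "X = N" using eq(1) by (simp add: prod_eq_iff fun_eq_iff fstN)
          then show ?thesis using \<open>N \<in> H\<close> by simp
        qed
      next
        case 3
        then obtain j where "snd N j < fst X j \<or> snd X j < fst N j"
          by (auto simp: meets_def not_le)
        then show ?thesis
          using X'[of j] by (auto simp: fstN sndN split: if_splits)
      qed
    qed
    moreover have "M \<notin> H"
      using HN[of M] sub_box_antisym[OF NM] \<open>N \<noteq> M\<close> by (auto simp: boxes_def)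
    moreover have "finite H" by (rule finite_max_system[OF H(1)])
    ultimately show ?thesis
      using H(2) cuts by (intro exI[of _ "insert M H"]) simp
  qed
qed

section \<open>From integer boxes back to bricks in real space\<close>

definition brick_of :: "'d::finite box \<Rightarrow> (real ^ 'd) set" where
  "brick_of X = cbox (\<chi> i. real_of_int (fst X i)) (\<chi> i. real_of_int (snd X i))"

lemma mem_brick_of: "x \<in> brick_of X \<longleftrightarrow> (\<forall>i. real_of_int (fst X i) \<le> x $ i \<and> x $ i \<le> real_of_int (snd X i))"
  by (auto simp: brick_of_def mem_box_cart)

text \<open>Inclusion is tested at the two extreme corners.\<close>

lemma brick_of_subset_iff:
  assumes "\<And>i. fst X i < snd X i"
  shows "brick_of X \<subseteq> brick_of Y \<longleftrightarrow> sub_box X Y"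
proof
  assume sub: "brick_of X \<subseteq> brick_of Y"
  have "(\<chi> i. real_of_int (fst X i)) \<in> brick_of X" "(\<chi> i. real_of_int (snd X i)) \<in> brick_of X"
    using assms by (auto simp: mem_brick_of less_imp_le)
  then have "(\<chi> i. real_of_int (fst X i)) \<in> brick_of Y" "(\<chi> i. real_of_int (snd X i)) \<in> brick_of Y"
    using sub by auto
  then show "sub_box X Y" by (auto simp: mem_brick_of sub_box_def)
next
  assume "sub_box X Y"
  then have "real_of_int (fst Y i) \<le> real_of_int (fst X i)" "real_of_int (snd X i) \<le> real_of_int (snd Y i)" for i
    by (auto simp: sub_box_def)
  then show "brick_of X \<subseteq> brick_of Y"
    unfolding mem_brick_of subset_iff by (meson order_trans)
qed

lemma brick_of_disjoint_iff:
  assumes "\<And>i. fst X i < snd X i" "\<And>i. fst Y i < snd Y i"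
  shows "brick_of X \<inter> brick_of Y = {} \<longleftrightarrow> \<not> meets X Y"
proof -
  have "meets X Y" if "x \<in> brick_of X" "x \<in> brick_of Y" for x
    unfolding meets_def
  proof
    fix i
    have "real_of_int (fst X i) \<le> real_of_int (snd Y i)" "real_of_int (fst Y i) \<le> real_of_int (snd X i)"
      using that unfolding mem_brick_of by (meson order_trans)+
    then show "fst X i \<le> snd Y i \<and> fst Y i \<le> snd X i" by simp
  qed
  \<comment> \<open>The coordinatewise maximum of the lower corners is a common point.\<close>
  moreover have "(\<chi> i. real_of_int (max (fst X i) (fst Y i))) \<in> brick_of X \<inter> brick_of Y" if "meets X Y"
    using that assms by (auto simp: mem_brick_of meets_def less_imp_le)
  ultimately show ?thesis by blast
qed

abbreviation ambient_box :: "('d::finite \<Rightarrow> nat) \<Rightarrow> 'd box" where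
  "ambient_box m \<equiv> (\<lambda>_. 0, \<lambda>i. int (m i))"

lemma bricks_eq: "bricks m = brick_of ` boxes (ambient_box m)"
proof (intro set_eqI iffI)
  fix B assume "B \<in> bricks m"
  then obtain a b where "B = brick_of (a, b)" "\<forall>i. 0 \<le> a i \<and> a i < b i \<and> b i \<le> int (m i)"
    by (auto simp: bricks_def brick_of_def)
  then show "B \<in> brick_of ` boxes (ambient_box m)"
    by (intro image_eqI[of _ _ "(a, b)"]) (auto simp: boxes_def sub_box_def)
next
  fix B assume "B \<in> brick_of ` boxes (ambient_box m)"
  then show "B \<in> bricks m"
    by (auto simp: bricks_def brick_of_def boxes_def sub_box_def)
qed

lemma inj_on_brick_of: "inj_on brick_of (boxes M)"
proof (rule inj_onI)
  fix X Y assume "X \<in> boxes M" "Y \<in> boxes M" "brick_of X = brick_of Y"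
  then have "sub_box X Y" "sub_box Y X"
    using brick_of_subset_iff[of X Y] brick_of_subset_iff[of Y X] by (auto simp: boxes_def)
  then show "X = Y" by (rule sub_box_antisym)
qed

lemma laminar_iff:
  assumes "X \<in> boxes M" "Y \<in> boxes M"
  shows "laminar X Y \<longleftrightarrow> brick_of X \<subseteq> brick_of Y \<or> brick_of Y \<subseteq> brick_of X \<or> brick_of X \<inter> brick_of Y = {}"
proof -
  have "\<And>i. fst X i < snd X i" "\<And>i. fst Y i < snd Y i"
    using assms by (auto simp: boxes_def)
  then show ?thesis
    by (simp add: laminar_def brick_of_subset_iff brick_of_disjoint_iff)
qed

lemma image_in_brick_island_systems_iff:
  assumes "H \<subseteq> boxes (ambient_box m)"
  shows "brick_of ` H \<in> brick_island_systems m \<longleftrightarrow> (\<forall>X\<in>H. \<forall>Y\<in>H. laminar X Y)"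
proof -
  have "brick_of ` H \<subseteq> bricks m"
    using assms by (auto simp: bricks_eq)
  moreover have "laminar X Y \<longleftrightarrow> brick_of X \<subseteq> brick_of Y \<or> brick_of Y \<subseteq> brick_of X \<or> brick_of X \<inter> brick_of Y = {}"
    if "X \<in> H" "Y \<in> H" for X Y
    using that assms by (intro laminar_iff) auto
  ultimately show ?thesis
    unfolding brick_island_systems_def by auto
qed

lemma laminar_sym: "laminar X Y \<longleftrightarrow> laminar Y X"
  by (auto simp: laminar_def meets_commute)

lemma maximal_brick_island_systems_eq:
  "maximal_brick_island_systems m = (`) brick_of ` {H. max_system (ambient_box m) H}"
proof (intro set_eqI iffI)
  fix \<H> assume max: "\<H> \<in> maximal_brick_island_systems m"
  then have sys: "\<H> \<in> brick_island_systems m"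
    by (simp add: maximal_brick_island_systems_def)
  then have "\<H> \<subseteq> brick_of ` boxes (ambient_box m)"
    by (simp add: brick_island_systems_def bricks_eq)
  then obtain H where H: "H \<subseteq> boxes (ambient_box m)" "\<H> = brick_of ` H"
    by (meson subset_imageE)
  then have comp: "\<forall>X\<in>H. \<forall>Y\<in>H. laminar X Y"
    using sys image_in_brick_island_systems_iff by blast
  \<comment> \<open>A compatible box could be adjoined, so by maximality its brick is already
    present, and injectivity of \<open>brick_of\<close> puts the box itself in
    \<open>H\<close>.\<close>
  have "X \<in> H" if X: "X \<in> boxes (ambient_box m)" "\<forall>Y\<in>H. laminar X Y" for X
  proof -
    have "\<forall>Y\<in>insert X H. \<forall>Z\<in>insert X H. laminar Y Z"
      using comp X(2) laminar_sym[of X] sub_box_refl[of X] laminar_def[of X X] by blast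
    then have "brick_of ` insert X H \<in> brick_island_systems m"
      using image_in_brick_island_systems_iff[of "insert X H" m] H X by auto
    moreover have "\<H> \<subseteq> brick_of ` insert X H" using H by auto
    ultimately have "brick_of ` insert X H = \<H>"
      using max unfolding maximal_brick_island_systems_def by blast
    then have "brick_of X \<in> brick_of ` H" using H by auto
    then show ?thesis
      using inj_on_image_mem_iff[OF inj_on_brick_of] X(1) H(1) by blast
  qed
  then have "max_system (ambient_box m) H"
    using H comp by (simp add: max_system_def)
  then show "\<H> \<in> (`) brick_of ` {H. max_system (ambient_box m) H}"
    using H by blast
next
  fix \<H> assume "\<H> \<in> (`) brick_of ` {H. max_system (ambient_box m) H}"
  then obtain H where H: "max_system (ambient_box m) H" "\<H> = brick_of ` H" by blast
  have Hb: "H \<subseteq> boxes (ambient_box m)" using H by (simp add: max_system_def)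
  have "\<H> \<in> brick_island_systems m"
    using H Hb image_in_brick_island_systems_iff by (auto simp: max_system_def)
  moreover have "\<H>' = \<H>" if sys: "\<H>' \<in> brick_island_systems m" and sub: "\<H> \<subseteq> \<H>'" for \<H>'
  proof -
    have "\<H>' \<subseteq> brick_of ` boxes (ambient_box m)"
      using sys by (simp add: brick_island_systems_def bricks_eq)
    then obtain H' where H': "H' \<subseteq> boxes (ambient_box m)" "\<H>' = brick_of ` H'"
      by (meson subset_imageE)
    have comp: "\<forall>X\<in>H'. \<forall>Y\<in>H'. laminar X Y"
      using sys H' image_in_brick_island_systems_iff by blast
    have "H \<subseteq> H'"
      using sub inj_on_image_subset_iff[OF inj_on_brick_of Hb H'(1)] H H' by blast
    have "H' \<subseteq> H"
    proof
      fix X assume "X \<in> H'"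
      then have "X \<in> boxes (ambient_box m)" "\<forall>Y\<in>H. laminar X Y"
        using H'(1) comp \<open>H \<subseteq> H'\<close> by blast+
      then show "X \<in> H" using H(1) unfolding max_system_def by blast
    qed
    then show ?thesis using \<open>H \<subseteq> H'\<close> H H' by blast
  qed
  ultimately show "\<H> \<in> maximal_brick_island_systems m"
    by (auto simp: maximal_brick_island_systems_def)
qed

theorem theorem1:
  fixes m :: "'d::finite \<Rightarrow> nat"
  assumes "\<And>i. m i > 0"
  shows "int (min_maximal_brick_islands m) = (\<Sum>i\<in>UNIV. int (m i)) - (int CARD('d) - 1)"
proof -
  let ?M = "ambient_box m"
  have M: "fst ?M i < snd ?M i" for i using assms by simp
  have card_eq: "card (brick_of ` H) = card H" if "max_system ?M H" for H
    using that by (intro card_image inj_on_subset[OF inj_on_brick_of]) (auto simp: max_system_def)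
  have "min_maximal_brick_islands m = cuts ?M + 1"
    unfolding min_maximal_brick_islands_def
  proof (rule Min_eqI)
    show "finite (card ` maximal_brick_island_systems m)"
      by (simp add: finite_maximal_brick_island_systems)
    show "cuts ?M + 1 \<le> n" if "n \<in> card ` maximal_brick_island_systems m" for n
      using that card_max_system_ge[OF _ M] card_eq unfolding maximal_brick_island_systems_eq by fastforce
    show "cuts ?M + 1 \<in> card ` maximal_brick_island_systems m"
    proof -
      obtain H where "max_system ?M H" "card H = cuts ?M + 1"
        using ex_max_system_card[of ?M] M by blast
      then show ?thesis
        using card_eq unfolding maximal_brick_island_systems_eq by (metis (mono_tags, lifting) imageI mem_Collect_eq)
    qed
  qed
  \<comment> \<open>Positivity of every \<open>m i\<close> ensures that \<open>nat\<close> in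
    \<open>cuts\<close> truncates nothing.\<close>
  moreover have "int (cuts ?M) = (\<Sum>i\<in>UNIV. int (m i) - 1)"
    unfolding cuts_def of_nat_sum by (rule sum.cong) (use assms in \<open>auto simp: Suc_le_eq\<close>)
  ultimately show ?thesis
    by (simp add: sum_subtractf)
qed

end
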